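(* Let $\lambda\in\mathbb{R}$, let $A=\begin{pmatrix}\lambda&1\\0&\lambda\end{pmatrix}$, and let $T:\mathbb{R}^2\to\mathbb{R}^2$, $Tx=Ax$. (i) If $|\lambda|>1$, then $T$ is strongly sensitive in weak topology. (ii) Otherwise, $T$ is not strongly sensitive in weak topology.
   Context: Let $\mathbb{N}=\{1,2,3,\dots\}$. Continuous linear functionals on $\mathbb{R}^2$ are identified with vectors $x^*\in\mathbb{R}^2$ via $\langle x,x^*\rangle=x_1x_1^*+x_2x_2^*$, and $p_{x^*}(x)=|\langle x,x^*\rangle|$. $T$ is strongly sensitive in weak topology if there is $\delta>0$ such that for every nonzero $x^*$, every $x_0\in\mathbb{R}^2$ and every $\varepsilon>0$ there exist $x,y\in\mathbb{R}^2$ and $n\in\mathbb{N}$ with $p_{x^*}(x-x_0)<\varepsilon$, $p_{x^*}(y-x_0)<\varepsilon$ and $p_{x^*}(T^nx-T^ny)>\delta$. *)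

theory Defs
  imports "HOL-Analysis.Analysis"
begin

(* The functional x* is represented by the vector xs, acting as x \<mapsto> x \<bullet> xs. *)
definition weak_seminorm :: "real^2 \<Rightarrow> real^2 \<Rightarrow> real" where
  "weak_seminorm xs x = \<bar>x \<bullet> xs\<bar>"

(* The constant \<delta> is uniform over all nonzero functionals; iterates are indexed from 1. *)
definition strongly_sensitive_weak :: "(real^2 \<Rightarrow> real^2) \<Rightarrow> bool" where
  "strongly_sensitive_weak T \<longleftrightarrow>
     (\<exists>\<delta>>0. \<forall>xs. xs \<noteq> 0 \<longrightarrow> (\<forall>x0. \<forall>\<epsilon>>0. \<exists>x y. \<exists>n\<ge>1.
        weak_seminorm xs (x - x0) < \<epsilon> \<and>
        weak_seminorm xs (y - x0) < \<epsilon> \<and>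
        weak_seminorm xs ((T ^^ n) x - (T ^^ n) y) > \<delta>))"

end

theory Submission
  imports Defs
begin

text \<open>
  How far \<open>T\<close> separates points, as seen by a functional \<open>x\<^sup>*\<close>, depends on whether \<open>x\<^sup>*\<close> is
  proportional to the second coordinate.

  The second coordinate is an eigenvector, with eigenvalue \<open>\<lambda>\<close>, of the transposed matrix. So if
  \<open>x\<^sup>*\<close> is a multiple of it, the \<open>n\<close>-th iterate stretches every \<open>x\<^sup>*\<close>-distance by
  exactly \<open>\<bar>\<lambda>\<bar>\<^sup>n\<close> (lemma \<open>weak_seminorm_iterate_second_coordinate\<close>). For
  \<open>\<bar>\<lambda>\<bar> > 1\<close> this separates any two points at positive distance; for \<open>\<bar>\<lambda>\<bar> \<le> 1\<close> it
  never increases distances, and this single functional defeats every candidate \<open>\<delta>\<close>.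

  If \<open>x\<^sup>*\<close> is not such a multiple, then \<open>T\<close> does not preserve the kernel of \<open>x\<^sup>*\<close>. A weak
  neighbourhood contains the whole translate of that line, along which one can move arbitrarily far
  at no cost, and a single application of \<open>T\<close> makes the displacement visible to \<open>x\<^sup>*\<close>
  (lemma \<open>weak_seminorm_kernel_direction\<close>). Hence one constant \<open>\<delta>\<close> serves all functionals,
  however small their norm.
\<close>

definition jordan_block :: "real \<Rightarrow> real^2^2" where
  "jordan_block lam = vector [vector [lam, 1], vector [0, lam]]"

lemma jordan_block_mult_inner:
  "(jordan_block lam *v x) \<bullet> xs = lam * (x \<bullet> xs) + x $ 2 * xs $ 1"
  by (simp add: jordan_block_def inner_vec_def matrix_vector_mult_def sum_2 algebra_simps)

lemma iterate_inner_second_coordinate: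
  assumes "xs $ 1 = 0"
  shows "(((\<lambda>x. jordan_block lam *v x) ^^ n) x) \<bullet> xs = lam ^ n * (x \<bullet> xs)"
  by (induction n) (simp_all add: jordan_block_mult_inner assms)

lemma weak_seminorm_iterate_second_coordinate:
  fixes lam :: real
  assumes "xs $ 1 = 0"
  defines "T \<equiv> \<lambda>x. jordan_block lam *v x"
  shows "weak_seminorm xs ((T ^^ n) x - (T ^^ n) y) = \<bar>lam\<bar> ^ n * weak_seminorm xs (x - y)"
proof -
  have "((T ^^ n) x - (T ^^ n) y) \<bullet> xs = lam ^ n * ((x - y) \<bullet> xs)"
    unfolding T_def inner_diff_left iterate_inner_second_coordinate[OF assms(1)]
    by (simp add: right_diff_distrib)
  then show ?thesis
    by (simp add: weak_seminorm_def abs_mult power_abs)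
qed

text \<open>
  The kernel of \<open>x\<^sup>*\<close> is spanned by \<open>(- x\<^sup>*\<^sub>2, x\<^sup>*\<^sub>1)\<close>, on whose image \<open>x\<^sup>*\<close> takes the value
  \<open>(x\<^sup>*\<^sub>1)\<^sup>2 > 0\<close>, so rescaling produces any prescribed value.
\<close>

lemma weak_seminorm_kernel_direction:
  assumes "xs $ 1 \<noteq> 0" and "c \<ge> 0"
  obtains v where "weak_seminorm xs v = 0" and "weak_seminorm xs (jordan_block lam *v v) = c"
proof
  define v :: "real^2" where "v = vector [- c * xs $ 2 / (xs $ 1)\<^sup>2, c / xs $ 1]"
  have ker: "v \<bullet> xs = 0"
    using assms by (simp add: v_def inner_vec_def sum_2 field_simps power2_eq_square)
  then show "weak_seminorm xs v = 0"
    by (simp add: weak_seminorm_def)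
  show "weak_seminorm xs (jordan_block lam *v v) = c"
    using assms by (simp add: weak_seminorm_def jordan_block_mult_inner ker) (simp add: v_def)
qed

lemma strongly_sensitive_weak_jordan_block:
  assumes "\<bar>lam\<bar> > 1"
  shows "strongly_sensitive_weak (\<lambda>x. jordan_block lam *v x)" (is "strongly_sensitive_weak ?T")
  unfolding strongly_sensitive_weak_def
proof (rule exI[of _ 1], intro conjI allI impI)
  fix xs x0 :: "real^2" and \<epsilon> :: real
  assume xs: "xs \<noteq> 0" and eps: "\<epsilon> > 0"
  have centre: "weak_seminorm xs (x0 - x0) < \<epsilon>"
    using eps by (simp add: weak_seminorm_def)
  show "\<exists>x y. \<exists>n\<ge>1. weak_seminorm xs (x - x0) < \<epsilon> \<and> weak_seminorm xs (y - x0) < \<epsilon> \<and>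
          weak_seminorm xs ((?T ^^ n) x - (?T ^^ n) y) > 1"
  proof (cases "xs $ 1 = 0")
    case True
    define v where "v = (\<epsilon> / 2 / (xs \<bullet> xs)) *\<^sub>R xs"
    have v: "weak_seminorm xs v = \<epsilon> / 2"
      using xs eps by (simp add: v_def weak_seminorm_def)
    obtain m where "2 / \<epsilon> < \<bar>lam\<bar> ^ m"
      using real_arch_pow[OF assms] by blast
    \<comment> \<open>The exponent is raised by one because iterates are counted from 1.\<close>
    also have "\<bar>lam\<bar> ^ m \<le> \<bar>lam\<bar> ^ Suc m"
      using assms by (intro power_increasing) auto
    finally have "1 < \<bar>lam\<bar> ^ Suc m * (\<epsilon> / 2)"
      using eps by (simp add: field_simps)
    then have "weak_seminorm xs ((?T ^^ Suc m) (x0 + v) - (?T ^^ Suc m) x0) > 1"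
      unfolding weak_seminorm_iterate_second_coordinate[OF True] by (simp add: v)
    moreover have "weak_seminorm xs (x0 + v - x0) < \<epsilon>"
      using v eps by simp
    ultimately show ?thesis
      using centre by (intro exI[of _ "x0 + v"] exI[of _ x0] exI[of _ "Suc m"]) simp
  next
    case False
    obtain v where v: "weak_seminorm xs v = 0" "weak_seminorm xs (jordan_block lam *v v) = 2"
      using weak_seminorm_kernel_direction[OF False, of 2] by auto
    have "weak_seminorm xs ((?T ^^ 1) (x0 + v) - (?T ^^ 1) x0) > 1"
      using v(2) by (simp add: matrix_vector_right_distrib)
    moreover have "weak_seminorm xs (x0 + v - x0) < \<epsilon>"
      using v(1) eps by simp
    ultimately show ?thesis
      using centre by (intro exI[of _ "x0 + v"] exI[of _ x0] exI[of _ 1]) simp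
  qed
qed simp

lemma not_strongly_sensitive_weak_jordan_block:
  assumes "\<bar>lam\<bar> \<le> 1"
  shows "\<not> strongly_sensitive_weak (\<lambda>x. jordan_block lam *v x)"
    (is "\<not> strongly_sensitive_weak ?T")
proof
  assume "strongly_sensitive_weak ?T"
  then obtain \<delta> where "\<delta> > 0" and sens: "\<And>xs x0 \<epsilon>. xs \<noteq> 0 \<Longrightarrow> \<epsilon> > 0 \<Longrightarrow>
      \<exists>x y. \<exists>n\<ge>1. weak_seminorm xs (x - x0) < \<epsilon> \<and> weak_seminorm xs (y - x0) < \<epsilon> \<and>
        weak_seminorm xs ((?T ^^ n) x - (?T ^^ n) y) > \<delta>"
    unfolding strongly_sensitive_weak_def by blast
  define xs :: "real^2" where "xs = axis 2 1"
  have xs: "xs \<noteq> 0" "xs $ 1 = 0"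
    by (simp_all add: xs_def axis_def vec_eq_iff exI[of _ 2])
  \<comment> \<open>Two points of the ball of radius \<open>\<delta> / 2\<close> are less than \<open>\<delta>\<close> apart.\<close>
  obtain x y n where near: "weak_seminorm xs x < \<delta> / 2" "weak_seminorm xs y < \<delta> / 2"
    and far: "weak_seminorm xs ((?T ^^ n) x - (?T ^^ n) y) > \<delta>"
    using sens[OF xs(1), of "\<delta> / 2" 0] \<open>\<delta> > 0\<close> by auto
  have "weak_seminorm xs ((?T ^^ n) x - (?T ^^ n) y) = \<bar>lam\<bar> ^ n * weak_seminorm xs (x - y)"
    by (rule weak_seminorm_iterate_second_coordinate[OF xs(2)])
  also have "\<dots> \<le> weak_seminorm xs (x - y)"
    using assms by (intro mult_left_le_one_le power_le_one) (auto simp: weak_seminorm_def)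
  also have "\<dots> < \<delta>"
    using near unfolding weak_seminorm_def inner_diff_left by linarith
  finally show False
    using far by simp
qed

theorem theorem5p3:
  fixes lam :: real and A :: "real^2^2" and T :: "real^2 \<Rightarrow> real^2"
  assumes A: "A = vector [vector [lam, 1], vector [0, lam]]"
    and T: "T = (\<lambda>x. A *v x)"
  shows "(\<bar>lam\<bar> > 1 \<longrightarrow> strongly_sensitive_weak T) \<and>
         (\<not> \<bar>lam\<bar> > 1 \<longrightarrow> \<not> strongly_sensitive_weak T)"
proof -
  have "T = (\<lambda>x. jordan_block lam *v x)"
    by (simp add: T A jordan_block_def)
  then show ?thesis
    using strongly_sensitive_weak_jordan_block not_strongly_sensitive_weak_jordan_block by simp
qed

end
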